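(* Let $f:\mathbb{R}^n\to\mathbb{R}$ be $L$-smooth with $\arg\min f\neq\emptyset$, let $f^\star=\min f$, and let $h>0$. Let $\{x_k\}_{k=0}^\infty\subset\mathbb{R}^n$ and $\{\eta_k\}_{k=0}^\infty\subset\mathbb{R}$ be sequences satisfying, for all $k\ge0$, $$\frac{x_{k+1}-x_k}{h}=-\eta_k\nabla f(x_k),\qquad f(x_{k+1})-f(x_k)=\eta_k\langle\nabla f(x_k),x_{k+1}-x_k\rangle,$$ and $\eta_k\neq0$ for any non-negative integer $k$. Then the following inequalities hold: $$\sum_{k=0}^{\infty}\|\nabla f(x_k)\|^2\leq\left(\frac{Lh}{2}+1\right)^2\frac{f(x_0)-f^\star}{h},$$ and, for every integer $k\ge0$, $$\min_{0\leq i\leq k}\|\nabla f(x_i)\|\leq\left(\frac{Lh}{2}+1\right)\sqrt{\frac{f(x_0)-f^\star}{(k+1)h}}.$$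
   Context: A function $f$ is $L$-smooth ($L>0$) if it is differentiable and $\nabla f$ is Lipschitz continuous with constant $L$. $\|\cdot\|$ is the Euclidean norm. *)

theory Defs
  imports "HOL-Analysis.Analysis"
begin

definition grad :: "('a::real_inner \<Rightarrow> real) \<Rightarrow> 'a \<Rightarrow> 'a" where
  "grad f x = (THE g. GDERIV f x :> g)"

lemma gderiv_unique:
  assumes "GDERIV f x :> g" "GDERIV f x :> g'"
  shows "g = g'"
proof -
  have "(\<lambda>h. h \<bullet> g) = (\<lambda>h. h \<bullet> g')"
    using assms has_derivative_unique unfolding gderiv_def by blast
  then have "h \<bullet> g = h \<bullet> g'" for h
    by meson
  then show ?thesis
    by (metis vector_eq_ldot)
qed

lemma grad_eqI: "GDERIV f x :> g \<Longrightarrow> grad f x = g"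
  unfolding grad_def using gderiv_unique by blast

lemma gderiv_grad:
  fixes f :: "'a::euclidean_space \<Rightarrow> real"
  assumes "f differentiable (at x)"
  shows "GDERIV f x :> grad f x"
proof -
  obtain D where D: "(f has_derivative D) (at x)"
    using assms unfolding differentiable_def by blast
  then have lin: "linear D"
    by (rule has_derivative_linear)
  have "D h = h \<bullet> adjoint D 1" for h
    using adjoint_works[OF lin, of h 1] by simp
  then have "D = (\<lambda>h. h \<bullet> adjoint D 1)" by blast
  with D have "GDERIV f x :> adjoint D 1"
    unfolding gderiv_def by simp
  then show ?thesis using grad_eqI by metis
qed

definition L_smooth :: "real \<Rightarrow> ('a::euclidean_space \<Rightarrow> real) \<Rightarrow> bool" where
  "L_smooth L f \<longleftrightarrow> L > 0 \<and> (\<forall>x. f differentiable (at x)) \<and> L-lipschitz_on UNIV (grad f)"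

definition argmin :: "('a \<Rightarrow> real) \<Rightarrow> 'a set" where
  "argmin f = {z. is_arg_min f (\<lambda>_. True) z}"

(* Only meaningful when the minimum is attained, i.e. when argmin f is nonempty. *)
definition min_value :: "('a \<Rightarrow> real) \<Rightarrow> real" where
  "min_value f = (LEAST v. v \<in> range f)"

lemma min_value_eq:
  assumes "z \<in> argmin f"
  shows "min_value f = f z"
  using assms unfolding argmin_def min_value_def is_arg_min_def
  by (intro Least_equality) (auto simp: not_less)

end

theory Submission
  imports Defs
begin

text \<open>
  By the quadratic bound for \<open>L\<close>-smooth functions, the prescribed increment
  \<open>-h \<eta>\<^sub>k\<^sup>2 \<parallel>\<nabla>f(x\<^sub>k)\<parallel>\<^sup>2\<close> differs from the first-order one, \<open>-h \<eta>\<^sub>k \<parallel>\<nabla>f(x\<^sub>k)\<parallel>\<^sup>2\<close>, by at most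
  \<open>(L/2) h\<^sup>2 \<eta>\<^sub>k\<^sup>2 \<parallel>\<nabla>f(x\<^sub>k)\<parallel>\<^sup>2\<close>. Away from critical points this forces
  \<open>\<bar>1 - \<eta>\<^sub>k\<bar> \<le> (L h / 2) \<bar>\<eta>\<^sub>k\<bar>\<close>, hence \<open>\<bar>\<eta>\<^sub>k\<bar> (L h / 2 + 1) \<ge> 1\<close>: each step decreases \<open>f\<close> by at
  least \<open>h \<parallel>\<nabla>f(x\<^sub>k)\<parallel>\<^sup>2 / (L h / 2 + 1)\<^sup>2\<close>, and these decreases telescope.
\<close>

lemma L_smooth_quadratic_bound:
  assumes "L_smooth L f"
  shows "\<bar>f (x + d) - f x - grad f x \<bullet> d\<bar> \<le> L / 2 * (norm d)\<^sup>2"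
proof -
  \<comment> \<open>The sign \<open>s\<close> lets one monotonicity argument give both halves of the
    absolute value, via \<open>s = 1\<close> and \<open>s = -1\<close>.\<close>
  have one_sided: "s * (f (x + d) - f x - grad f x \<bullet> d) \<le> L / 2 * (norm d)\<^sup>2"
    if s: "\<bar>s\<bar> = 1" for s :: real
  proof -
    define \<phi> where
      "\<phi> t = s * (f (x + t *\<^sub>R d) - t * (grad f x \<bullet> d)) - L / 2 * t\<^sup>2 * (norm d)\<^sup>2" for t
    define \<phi>' where
      "\<phi>' t = s * (grad f (x + t *\<^sub>R d) \<bullet> d - grad f x \<bullet> d) - L * t * (norm d)\<^sup>2" for t
    have der: "(\<phi> has_real_derivative \<phi>' t) (at t)" for t
    proof -
      have "f differentiable at (x + t *\<^sub>R d)"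
        using assms by (simp add: L_smooth_def)
      then have "(f has_derivative (\<lambda>v. v \<bullet> grad f (x + t *\<^sub>R d))) (at (x + t *\<^sub>R d))"
        using gderiv_grad unfolding gderiv_def by blast
      moreover have "((\<lambda>t. x + t *\<^sub>R d) has_derivative (\<lambda>u. u *\<^sub>R d)) (at t)"
        by (auto intro!: derivative_eq_intros)
      ultimately have "((\<lambda>t. f (x + t *\<^sub>R d)) has_derivative
          (\<lambda>u. (u *\<^sub>R d) \<bullet> grad f (x + t *\<^sub>R d))) (at t)"
        by (rule has_derivative_compose[rotated])
      then have "((\<lambda>t. f (x + t *\<^sub>R d)) has_real_derivative grad f (x + t *\<^sub>R d) \<bullet> d) (at t)"
        by (rule has_derivative_imp_has_field_derivative) (simp add: inner_commute)
      then show ?thesis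
        unfolding \<phi>_def \<phi>'_def by (auto intro!: derivative_eq_intros)
    qed
    \<comment> \<open>Cauchy-Schwarz and the Lipschitz bound on the gradient over a displacement of
      length \<open>t * norm d\<close> control the first term of \<open>\<phi>'\<close> by exactly
      the second.\<close>
    have nonpos: "\<phi>' t \<le> 0" if "0 \<le> t" for t
    proof -
      have "norm (grad f (x + t *\<^sub>R d) - grad f x) \<le> L * (t * norm d)"
        using assms lipschitz_onD[of L UNIV "grad f" "x + t *\<^sub>R d" x] that
        by (simp add: L_smooth_def dist_norm)
      then have "norm (grad f (x + t *\<^sub>R d) - grad f x) * norm d \<le> L * (t * norm d) * norm d"
        by (simp add: mult_right_mono)
      moreover have "s * ((grad f (x + t *\<^sub>R d) - grad f x) \<bullet> d)
          \<le> \<bar>(grad f (x + t *\<^sub>R d) - grad f x) \<bullet> d\<bar>"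
        using s by (metis abs_ge_self abs_mult mult_1)
      ultimately show ?thesis
        using Cauchy_Schwarz_ineq2[of "grad f (x + t *\<^sub>R d) - grad f x" d]
        by (simp add: \<phi>'_def inner_diff_left power2_eq_square mult.assoc)
    qed
    have "\<phi> 1 \<le> \<phi> 0"
      by (rule DERIV_nonpos_imp_nonincreasing) (use der nonpos in auto)
    then show ?thesis
      by (simp add: \<phi>_def algebra_simps)
  qed
  show ?thesis
    using one_sided[of 1] one_sided[of "-1"] unfolding abs_le_iff by simp
qed

lemma L_smooth_step_decrease:
  assumes "L_smooth L f" and "h > 0" and "\<eta> \<noteq> 0"
    and step: "(y - x) /\<^sub>R h = - (\<eta> *\<^sub>R grad f x)"
    and incr: "f y - f x = \<eta> * (grad f x \<bullet> (y - x))"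
  shows "(norm (grad f x))\<^sup>2 \<le> (L * h / 2 + 1)\<^sup>2 * ((f x - f y) / h)"
proof -
  define G where "G = (norm (grad f x))\<^sup>2"
  have "y - x = h *\<^sub>R ((y - x) /\<^sub>R h)"
    using \<open>h > 0\<close> by simp
  then have d: "y - x = - (h * \<eta>) *\<^sub>R grad f x"
    unfolding step by simp
  have inner_d: "grad f x \<bullet> (y - x) = - (h * \<eta> * G)"
    by (simp add: d G_def power2_norm_eq_inner)
  have norm_d: "(norm (y - x))\<^sup>2 = h\<^sup>2 * \<eta>\<^sup>2 * G"
    by (simp add: d G_def power_mult_distrib)
  have decrease: "(f x - f y) / h = \<eta>\<^sup>2 * G"
    using incr \<open>h > 0\<close> by (simp add: inner_d field_simps power2_eq_square)
  have "G \<le> (L * h / 2 + 1)\<^sup>2 * (\<eta>\<^sup>2 * G)"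
  \<comment> \<open>At a critical point both sides vanish; elsewhere the positive factor
    \<open>h * G * \<bar>\<eta>\<bar>\<close> can be cancelled.\<close>
  proof (cases "G = 0")
    case False
    then have "G > 0" by (simp add: G_def)
    have "f y - f x - grad f x \<bullet> (y - x) = (h * G * \<eta>) * (1 - \<eta>)"
      unfolding incr inner_d by (simp add: algebra_simps)
    then have "h * G * \<bar>\<eta>\<bar> * \<bar>1 - \<eta>\<bar> = \<bar>f y - f x - grad f x \<bullet> (y - x)\<bar>"
      using \<open>h > 0\<close> \<open>G > 0\<close> by (simp add: abs_mult)
    also have "\<dots> \<le> L / 2 * (norm (y - x))\<^sup>2"
      using L_smooth_quadratic_bound[OF assms(1), of x "y - x"] by simp
    also have "\<dots> = h * G * \<bar>\<eta>\<bar> * (L * h / 2 * \<bar>\<eta>\<bar>)"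
      unfolding norm_d by (simp add: power2_eq_square ac_simps)
    finally have "h * G * \<bar>\<eta>\<bar> * \<bar>1 - \<eta>\<bar> \<le> h * G * \<bar>\<eta>\<bar> * (L * h / 2 * \<bar>\<eta>\<bar>)" .
    moreover have "h * G * \<bar>\<eta>\<bar> > 0"
      using \<open>h > 0\<close> \<open>G > 0\<close> \<open>\<eta> \<noteq> 0\<close> by simp
    ultimately have "\<bar>1 - \<eta>\<bar> \<le> L * h / 2 * \<bar>\<eta>\<bar>"
      using mult_le_cancel_left_pos by blast
    \<comment> \<open>Triangle inequality: 1 is at most
      \<open>\<bar>1 - \<eta>\<bar> + \<bar>\<eta>\<bar>\<close>, whatever the sign of
      \<open>\<eta>\<close>.\<close>
    then have "1 \<le> (L * h / 2 + 1) * \<bar>\<eta>\<bar>"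
      unfolding distrib_right by linarith
    then have "1 \<le> ((L * h / 2 + 1) * \<bar>\<eta>\<bar>)\<^sup>2"
      by (rule one_le_power)
    then have "1 * G \<le> ((L * h / 2 + 1) * \<bar>\<eta>\<bar>)\<^sup>2 * G"
      using \<open>G > 0\<close> by (intro mult_right_mono) auto
    then show ?thesis
      by (simp add: power_mult_distrib mult.assoc)
  qed simp
  then show ?thesis
    by (simp add: decrease flip: G_def)
qed

theorem theorem4p1:
  fixes f :: "real ^ 'n \<Rightarrow> real"
    and L h f_star :: real
    and x :: "nat \<Rightarrow> real ^ 'n"
    and \<eta> :: "nat \<Rightarrow> real"
  assumes "L_smooth L f"
    and "argmin f \<noteq> {}"
    and "f_star = min_value f"
    and "h > 0"
    and "\<And>k. (x (Suc k) - x k) /\<^sub>R h = - (\<eta> k *\<^sub>R grad f (x k))"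
    and "\<And>k. f (x (Suc k)) - f (x k) = \<eta> k * (grad f (x k) \<bullet> (x (Suc k) - x k))"
    and "\<And>k. \<eta> k \<noteq> 0"
  shows "summable (\<lambda>k. (norm (grad f (x k)))\<^sup>2)
    \<and> (\<Sum>k. (norm (grad f (x k)))\<^sup>2) \<le> (L * h / 2 + 1)\<^sup>2 * ((f (x 0) - f_star) / h)
    \<and> (\<forall>k. (MIN i\<in>{0..k}. norm (grad f (x i)))
          \<le> (L * h / 2 + 1) * sqrt ((f (x 0) - f_star) / ((real k + 1) * h)))"
proof -
  define g where "g i = norm (grad f (x i))" for i
  define c where "c = L * h / 2 + 1"
  have "c > 0"
    using assms(1) \<open>h > 0\<close> by (simp add: c_def L_smooth_def add_pos_pos)
  obtain z where z: "z \<in> argmin f"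
    using assms(2) by blast
  have ge_star: "f_star \<le> f y" for y
    using min_value_eq[OF z] z assms(3) by (auto simp: argmin_def is_arg_min_def not_less)
  \<comment> \<open>A bound uniform in \<open>n\<close> serves both claims: it yields convergence
    and the value of the series, and with \<open>n = Suc k\<close> the rate for the minimum.\<close>
  have partial: "(\<Sum>i<n. (g i)\<^sup>2) \<le> c\<^sup>2 * ((f (x 0) - f_star) / h)" for n
  proof -
    have "(\<Sum>i<n. (g i)\<^sup>2) \<le> (\<Sum>i<n. c\<^sup>2 * ((f (x i) - f (x (Suc i))) / h))"
      unfolding g_def c_def
      by (intro sum_mono L_smooth_step_decrease[OF assms(1,4,7,5,6)])
    also have "\<dots> = c\<^sup>2 * ((f (x 0) - f (x n)) / h)"
      using sum_lessThan_telescope'[of "\<lambda>i. f (x i)" n]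
      by (simp flip: sum_distrib_left sum_divide_distrib)
    also have "\<dots> \<le> c\<^sup>2 * ((f (x 0) - f_star) / h)"
      using ge_star[of "x n"] \<open>h > 0\<close> by (intro mult_left_mono divide_right_mono) auto
    finally show ?thesis .
  qed
  have summable: "summable (\<lambda>i. (g i)\<^sup>2)"
    by (rule summableI_nonneg_bounded[OF _ partial]) simp
  have "(\<Sum>i. (g i)\<^sup>2) \<le> c\<^sup>2 * ((f (x 0) - f_star) / h)"
    by (rule suminf_le_const[OF summable partial])
  moreover have "(MIN i\<in>{0..k}. g i) \<le> c * sqrt ((f (x 0) - f_star) / ((real k + 1) * h))"
    for k
  proof -
    define m where "m = (MIN i\<in>{0..k}. g i)"
    have "m \<in> g ` {0..k}"
      unfolding m_def by (intro Min_in) auto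
    then have "m \<ge> 0"
      by (auto simp: g_def)
    \<comment> \<open>The squared minimum is at most the average of the \<open>k + 1\<close> squares
      with indices 0 to \<open>k\<close>.\<close>
    have "(real k + 1) * m\<^sup>2 = (\<Sum>i<Suc k. m\<^sup>2)"
      by simp
    also have "\<dots> \<le> (\<Sum>i<Suc k. (g i)\<^sup>2)"
      using \<open>m \<ge> 0\<close> by (intro sum_mono power_mono) (auto simp: m_def)
    also have "\<dots> \<le> c\<^sup>2 * ((f (x 0) - f_star) / h)"
      by (rule partial)
    finally have "m\<^sup>2 \<le> c\<^sup>2 * ((f (x 0) - f_star) / h) / (real k + 1)"
      by (subst pos_le_divide_eq) (simp_all add: mult.commute)
    then have "m\<^sup>2 \<le> c\<^sup>2 * ((f (x 0) - f_star) / ((real k + 1) * h))"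
      by (simp add: mult.commute)
    then have "m \<le> sqrt (c\<^sup>2 * ((f (x 0) - f_star) / ((real k + 1) * h)))"
      by (rule real_le_rsqrt)
    then show ?thesis
      using \<open>c > 0\<close> by (simp only: real_sqrt_mult real_sqrt_abs abs_of_pos m_def)
  qed
  ultimately show ?thesis
    using summable unfolding g_def c_def by blast
qed

end
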